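(* Let $f:\mathbb{R}^d\to\mathbb{R}_{\ge 0}$ have a global minimizer $x^\star$, with $f^\star=f(x^\star)$, let $v>0$ and $\mathcal{X}=\{x\in\mathbb{R}^d: f(x)\le v\}$. Let $L,D,\mu,G>0$ and suppose that: (i) $f$ is locally $(L,D)$-smooth over $\mathcal{X}$: $\|\nabla f(x)-\nabla f(y)\|\le L\|x-y\|$ for all $x\in\mathcal{X}$ and all $y\in\mathbb{R}^d$ with $\|y-x\|\le D$ (in particular $f$ is differentiable at all such points); (ii) $f(x)-f^\star\le\frac{1}{2\mu}\|\nabla f(x)\|^2$ for all $x\in\mathcal{X}$; (iii) $\|\nabla f(x)\|\le G$ for all $x\in\mathcal{X}$. Let $T\ge1$ be an integer and let $\{n_t\}_{t\ge0}$ be independent $\mathbb{R}^d$-valued random variables with $\mathbb{E}[n_t]=0$, $\mathbb{E}[\|n_t\|^2]=\sigma_N^2$, and $\Pr(\|n_t\|\le\Delta)=1$ for all $t$, where $\Delta>0$. Let $0<\eta<\min\{D/G,\,1/(4L)\}$ with $\mu\eta<1$, define $\gamma=\sqrt{1-\mu\eta}$ and $$\sigma_{lb}^2:=G^2\Delta^2\max\left(\frac{\eta^2}{(D-G\eta)^2},\frac{2}{\mu v}\right),$$ with $\sigma_{lb}>0$, and suppose the average power budget satisfies $\bar\sigma_p^2\ge\sigma_{lb}^2$. Let $\{\sigma_t\}_{t=0}^{T-1}$ and $t_{\mathrm{switch}}$ be given by the Constant-then-Geometric allocation $\mathrm{CtG}(T,\bar\sigma_p^2,\mu,\eta,\sigma_{lb})$.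 Let $x_0\in\mathbb{R}^d$ be deterministic with $f(x_0)\le v/2$ and let the iterates of Power-Allocated Gradient Descent be $$x_{t+1}=x_t-\eta\left(\nabla f(x_t)+\frac{G}{\sigma_t}n_t\right),\qquad t=0,\dots,T-1.$$ Then, almost surely, $x_t\in\mathcal{X}$ for all $t\in\{0,\dots,T\}$, and $$\mathbb{E}[f(x_T)-f^\star]\le(1-\mu\eta)^T(f(x_0)-f^\star)+LG^2\eta^2\sigma_N^2\left(\frac{\sum_{t=0}^{t_{\mathrm{switch}}-1}\gamma^{2(T-t-1)}}{\sigma_{lb}^2}+\frac{\left(\sum_{t=t_{\mathrm{switch}}}^{T-1}\gamma^{T-t-1}\right)^2}{T\bar\sigma_p^2-t_{\mathrm{switch}}\sigma_{lb}^2}\right).$$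
   Context: $\|\cdot\|$ is the Euclidean norm; empty sums are $0$. Constant-then-Geometric allocation $\mathrm{CtG}(T,\bar\sigma_p^2,\mu,\eta,\sigma_{lb})$ (defined when $\bar\sigma_p^2\ge\sigma_{lb}^2$): with $\gamma=\sqrt{1-\mu\eta}$, set $$t_{\mathrm{switch}}=\min\left\{t\in\{0,\dots,T-1\}:\ \gamma^{T-1-t}\ge\frac{1-\gamma^{T-t}}{1-\gamma}\cdot\frac{\sigma_{lb}^2}{T\bar\sigma_p^2-t\,\sigma_{lb}^2}\right\},$$ and for $t\in\{0,\dots,T-1\}$ let $\sigma_t>0$ be given by $$\sigma_t^2=\sigma_{lb}^2\ \text{ if } t<t_{\mathrm{switch}},\qquad \sigma_t^2=\frac{\gamma^{T-1-t}}{\sum_{\ell=t_{\mathrm{switch}}}^{T-1}\gamma^{T-\ell-1}}\left(T\bar\sigma_p^2-t_{\mathrm{switch}}\sigma_{lb}^2\right)\ \text{ if } t\ge t_{\mathrm{switch}}.$$ Power-Allocated Gradient Descent (PAGD): at time $t$ a worker transmits $\sigma_t\nabla f(x_t)/G$ over a noisy channel; the server receives $g_t=\sigma_t\nabla f(x_t)/G+n_t$, decodes it as $\frac{G}{\sigma_t}g_t$, and updates $x_{t+1}=x_t-\eta\frac{G}{\sigma_t}g_t$, which is the recursion in the claim (on the event where $f$ fails to be differentiable at some iterate, the gradient may be assigned an arbitrary value). The average power constraint is $\frac1T\sum_{t=0}^{T-1}\sigma_t^2\le\bar\sigma_p^2$. *)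

theory Defs
  imports "HOL-Probability.Probability"
begin

(* A choice of gradient field: it is the gradient wherever f is differentiable and
   arbitrary elsewhere. *)
definition gradient_field :: "(real^'d \<Rightarrow> real) \<Rightarrow> (real^'d \<Rightarrow> real^'d) \<Rightarrow> bool" where
  "gradient_field f gf \<longleftrightarrow> (\<forall>x. f differentiable (at x) \<longrightarrow> (GDERIV f x :> gf x))"

definition locally_smooth_on ::
  "real \<Rightarrow> real \<Rightarrow> (real^'d) set \<Rightarrow> (real^'d \<Rightarrow> real) \<Rightarrow> (real^'d \<Rightarrow> real^'d) \<Rightarrow> bool" where
  "locally_smooth_on L D S f gf \<longleftrightarrow>
     (\<forall>x\<in>S. \<forall>y. norm (y - x) \<le> D \<longrightarrow>
        f differentiable (at y) \<and> norm (gf x - gf y) \<le> L * norm (x - y))"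

definition ctg_gamma :: "real \<Rightarrow> real \<Rightarrow> real" where
  "ctg_gamma \<mu> \<eta> = sqrt (1 - \<mu> * \<eta>)"

(* P is the average power budget, hence already a square, while slb is not squared.
   When 0 < T, 0 < \<mu> * \<eta> < 1 and P \<ge> slb^2 > 0, the set below contains T - 1,
   so Min is applied to a finite nonempty set. *)
definition ctg_switch :: "nat \<Rightarrow> real \<Rightarrow> real \<Rightarrow> real \<Rightarrow> real \<Rightarrow> nat" where
  "ctg_switch T P \<mu> \<eta> slb = (let \<gamma> = ctg_gamma \<mu> \<eta> in
     Min {t \<in> {0..T - 1}.
       \<gamma> ^ (T - 1 - t) \<ge>
         (1 - \<gamma> ^ (T - t)) / (1 - \<gamma>) * (slb\<^sup>2 / (real T * P - real t * slb\<^sup>2))})"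

definition ctg_power :: "nat \<Rightarrow> real \<Rightarrow> real \<Rightarrow> real \<Rightarrow> real \<Rightarrow> nat \<Rightarrow> real" where
  "ctg_power T P \<mu> \<eta> slb t =
     (let \<gamma> = ctg_gamma \<mu> \<eta>; ts = ctg_switch T P \<mu> \<eta> slb in
      if t < ts then slb\<^sup>2
      else \<gamma> ^ (T - 1 - t) / (\<Sum>l=ts..<T. \<gamma> ^ (T - l - 1)) * (real T * P - real ts * slb\<^sup>2))"

definition ctg_sigma :: "nat \<Rightarrow> real \<Rightarrow> real \<Rightarrow> real \<Rightarrow> real \<Rightarrow> nat \<Rightarrow> real" where
  "ctg_sigma T P \<mu> \<eta> slb t = sqrt (ctg_power T P \<mu> \<eta> slb t)"

(* The iterates along a single noise realisation n. *)
primrec pagd ::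
  "(real^'d \<Rightarrow> real^'d) \<Rightarrow> real \<Rightarrow> real \<Rightarrow> (nat \<Rightarrow> real) \<Rightarrow> real^'d \<Rightarrow> (nat \<Rightarrow> real^'d)
     \<Rightarrow> nat \<Rightarrow> real^'d" where
  "pagd gf \<eta> G \<sigma> x0 n 0 = x0"
| "pagd gf \<eta> G \<sigma> x0 n (Suc t) =
     pagd gf \<eta> G \<sigma> x0 n t
       - \<eta> *\<^sub>R (gf (pagd gf \<eta> G \<sigma> x0 n t) + (G / \<sigma> t) *\<^sub>R n t)"

end

theory Submission
  imports Defs
begin

text \<open>Every transmit power of the allocation is at least \<open>\<sigma>lb\<^sup>2\<close>. This makes each step shorter than \<open>D\<close>,
  so that the local smoothness yields the descent inequality, and it makes the decoded noise so
  small that the optimality gap never exceeds \<open>v / 2\<close>, whence the iterates stay in the sublevel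
  set almost surely. In expectation the cross term vanishes, since the iterate at time \<open>t\<close> depends
  only on the noise before \<open>t\<close>; the gap thus contracts by \<open>1 - \<mu> * \<eta> = \<gamma>\<^sup>2\<close> up to a noise term
  proportional to \<open>1 / (\<sigma> t)\<^sup>2\<close>. In the geometric phase \<open>\<gamma> ^ (2 * (T - t - 1)) / (\<sigma> t)\<^sup>2\<close> is a multiple
  of \<open>\<gamma> ^ (T - t - 1)\<close>, and its sum is the square in the bound.\<close>

section \<open>Recurrences, iterates, independence and completed measures\<close>

lemma linear_recurrence_bound:
  fixes a c :: "nat \<Rightarrow> real"
  assumes "0 \<le> q" and "\<And>t. t < T \<Longrightarrow> a (Suc t) \<le> q * a t + c t"
  shows "a T \<le> q ^ T * a 0 + (\<Sum>t<T. q ^ (T - Suc t) * c t)"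
  using assms(2)
proof (induction T)
  case 0
  then show ?case by simp
next
  case (Suc T)
  have "(\<Sum>t<T. q ^ (T - t) * c t) = (\<Sum>t<T. q * (q ^ (T - Suc t) * c t))"
  proof (rule sum.cong)
    fix t assume "t \<in> {..<T}"
    \<comment> \<open>Subtraction on naturals is truncated, so \<open>t < T\<close> is what splits
      one factor \<open>q\<close> off the power.\<close>
    then have "T - t = Suc (T - Suc t)" by auto
    then show "q ^ (T - t) * c t = q * (q ^ (T - Suc t) * c t)" by (simp add: mult.assoc)
  qed simp
  then have "q ^ Suc T * a 0 + (\<Sum>t<Suc T. q ^ (Suc T - Suc t) * c t)
      = q * (q ^ T * a 0 + (\<Sum>t<T. q ^ (T - Suc t) * c t)) + c T"
    by (simp add: sum_distrib_left algebra_simps)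
  moreover have "a (Suc T) \<le> q * a T + c T" using Suc.prems by simp
  moreover have "q * a T \<le> q * (q ^ T * a 0 + (\<Sum>t<T. q ^ (T - Suc t) * c t))"
    using Suc by (intro mult_left_mono assms(1)) simp
  ultimately show ?case by linarith
qed

lemma pagd_cong:
  assumes "\<And>s. s < t \<Longrightarrow> w s = w' s"
  shows "pagd g \<eta> G \<sigma> x0 w t = pagd g \<eta> G \<sigma> x0 w' t"
  using assms by (induction t) auto

text \<open>The measure \<open>N\<close> is left arbitrary because it is taken both as the
  probability space itself and as the product space carrying only the noise before
  \<open>t\<close>.\<close>

lemma measurable_pagd:
  assumes [measurable]: "g \<in> borel_measurable borel"
    and "\<And>s. s < t \<Longrightarrow> (\<lambda>\<omega>. w \<omega> s) \<in> borel_measurable N"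
  shows "(\<lambda>\<omega>. pagd g \<eta> G \<sigma> x0 (w \<omega>) t) \<in> borel_measurable N"
  using assms(2)
proof (induction t)
  case 0
  then show ?case by simp
next
  case (Suc t)
  then have [measurable]: "(\<lambda>\<omega>. pagd g \<eta> G \<sigma> x0 (w \<omega>) t) \<in> borel_measurable N"
      "(\<lambda>\<omega>. w \<omega> t) \<in> borel_measurable N"
    by auto
  show ?case by simp
qed

text \<open>Coordinates of independent vectors are independent real variables, so the scalar product
  rule applies to each term of the inner product over \<open>Basis\<close>.\<close>

lemma (in prob_space) indep_var_inner:
  fixes X Y :: "'a \<Rightarrow> 'b :: euclidean_space"
  assumes indep: "indep_var borel X borel Y" and X: "integrable M X" and Y: "integrable M Y"
  shows integrable_inner_indep: "integrable M (\<lambda>\<omega>. X \<omega> \<bullet> Y \<omega>)"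
    and expectation_inner_indep:
      "expectation (\<lambda>\<omega>. X \<omega> \<bullet> Y \<omega>) = integral\<^sup>L M X \<bullet> integral\<^sup>L M Y"
proof -
  have ind: "indep_var borel (\<lambda>\<omega>. X \<omega> \<bullet> b) borel (\<lambda>\<omega>. Y \<omega> \<bullet> b)" for b
    using indep_var_compose[OF indep, of "\<lambda>x. x \<bullet> b" borel "\<lambda>x. x \<bullet> b" borel]
    by (simp add: comp_def)
  have int: "integrable M (\<lambda>\<omega>. (X \<omega> \<bullet> b) * (Y \<omega> \<bullet> b))" for b
    using X Y by (intro indep_var_integrable ind) auto
  have eq: "X \<omega> \<bullet> Y \<omega> = (\<Sum>b\<in>Basis. (X \<omega> \<bullet> b) * (Y \<omega> \<bullet> b))" for \<omega>
    by (rule euclidean_inner)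
  show "integrable M (\<lambda>\<omega>. X \<omega> \<bullet> Y \<omega>)"
    unfolding eq by (intro Bochner_Integration.integrable_sum int)
  have "expectation (\<lambda>\<omega>. X \<omega> \<bullet> Y \<omega>)
      = (\<Sum>b\<in>Basis. expectation (\<lambda>\<omega>. (X \<omega> \<bullet> b) * (Y \<omega> \<bullet> b)))"
    unfolding eq by (intro Bochner_Integration.integral_sum int)
  also have "\<dots> = (\<Sum>b\<in>Basis. (integral\<^sup>L M X \<bullet> b) * (integral\<^sup>L M Y \<bullet> b))"
    using X Y by (intro sum.cong refl) (simp add: indep_var_lebesgue_integral[OF ind])
  finally show "expectation (\<lambda>\<omega>. X \<omega> \<bullet> Y \<omega>) = integral\<^sup>L M X \<bullet> integral\<^sup>L M Y"
    by (subst euclidean_inner)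
qed

text \<open>A function agreeing almost everywhere with a measurable one need not be measurable
  itself, but it is so for the completed measure. This serves the gap at the last iterate, since
  \<open>f\<close> is controlled only near the sublevel set.\<close>

lemma
  fixes h g :: "'a \<Rightarrow> real"
  assumes h: "integrable M h" and eq: "AE \<omega> in M. g \<omega> = h \<omega>"
  shows integrable_completion_AE: "integrable (completion M) g"
    and integral_completion_AE: "integral\<^sup>L (completion M) g = integral\<^sup>L M h"
proof -
  have hM [measurable]: "h \<in> borel_measurable M" using h by simp
  have eqc: "AE \<omega> in completion M. h \<omega> = g \<omega>"
    using AE_completion[OF eq] by (auto elim: eventually_mono)
  have hc: "h \<in> borel_measurable (completion M)" by (rule measurable_completion[OF hM])
  have gc: "g \<in> borel_measurable (completion M)"
  \<comment> \<open>The preimages of a Borel set under \<open>g\<close> and \<open>h\<close> differ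
    only within a null set.\<close>
  proof (rule measurableI)
    fix A :: "real set" assume A: "A \<in> sets borel"
    show "g -` A \<inter> space (completion M) \<in> sets (completion M)"
    proof (rule completion.in_sets_AE)
      show "AE x in completion M. x \<in> h -` A \<inter> space (completion M)
          \<longleftrightarrow> x \<in> g -` A \<inter> space (completion M)"
        using eqc by eventually_elim auto
      show "h -` A \<inter> space (completion M) \<in> sets (completion M)"
        using hc A by (rule measurable_sets)
    qed auto
  qed simp
  have hi: "integrable (completion M) h"
    using h by (simp add: integrable_completion)
  then show "integrable (completion M) g"
    using integrable_cong_AE[OF hc gc eqc] by simp
  show "integral\<^sup>L (completion M) g = integral\<^sup>L M h"
    using integral_cong_AE[OF hc gc eqc] by (simp add: integral_completion)
qed

section \<open>The descent inequality under local smoothness\<close>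

text \<open>Every gradient on the segment is compared with \<open>gf x\<close>, so it suffices that
  \<open>x\<close> lies in \<open>S\<close> and that the segment stays within distance
  \<open>D\<close> of it.\<close>

lemma locally_smooth_descent:
  assumes grad: "gradient_field f gf" and smooth: "locally_smooth_on L D S f gf"
    and x: "x \<in> S" and y: "norm (y - x) \<le> D"
  shows "f y \<le> f x + gf x \<bullet> (y - x) + L / 2 * (norm (y - x))\<^sup>2"
proof -
  define d where "d = y - x"
  \<comment> \<open>\<open>\<phi>\<close> is \<open>f\<close> along the segment minus its linear
    part and the quadratic bound. Cauchy-Schwarz and the Lipschitz estimate make its derivative
    nonpositive.\<close>
  define \<phi> where "\<phi> s = f (x + s *\<^sub>R d) - s * (gf x \<bullet> d) - L / 2 * (norm d)\<^sup>2 * s\<^sup>2" for s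
  have "\<phi> 1 \<le> \<phi> 0"
  proof (rule DERIV_nonpos_imp_nonincreasing[where f = \<phi>])
    fix s :: real assume s: "0 \<le> s" "s \<le> 1"
    have "norm (x + s *\<^sub>R d - x) \<le> D"
      using s y mult_left_le_one_le[of "norm d" s] by (simp add: d_def)
    then have diff: "f differentiable (at (x + s *\<^sub>R d))"
      and lip: "norm (gf x - gf (x + s *\<^sub>R d)) \<le> L * norm (x - (x + s *\<^sub>R d))"
      using smooth x unfolding locally_smooth_on_def by blast+
    have "GDERIV f (x + s *\<^sub>R d) :> gf (x + s *\<^sub>R d)"
      using grad diff unfolding gradient_field_def by blast
    then have F: "(f has_derivative (\<lambda>h. h \<bullet> gf (x + s *\<^sub>R d))) (at (x + s *\<^sub>R d))"
      unfolding gderiv_def .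
    have "((\<lambda>s. x + s *\<^sub>R d) has_derivative (\<lambda>h. h *\<^sub>R d)) (at s)"
      by (auto intro!: derivative_eq_intros)
    from has_derivative_compose[OF this F]
    have "((\<lambda>s. f (x + s *\<^sub>R d)) has_real_derivative (d \<bullet> gf (x + s *\<^sub>R d))) (at s)"
      by (simp add: has_field_derivative_def mult_commute_abs)
    then have deriv: "(\<phi> has_real_derivative
        (d \<bullet> gf (x + s *\<^sub>R d) - gf x \<bullet> d - L * (norm d)\<^sup>2 * s)) (at s)"
      unfolding \<phi>_def by (auto intro!: derivative_eq_intros)
    have "d \<bullet> gf (x + s *\<^sub>R d) - gf x \<bullet> d = d \<bullet> (gf (x + s *\<^sub>R d) - gf x)"
      by (simp add: inner_diff_right inner_commute)
    also have "\<dots> \<le> norm d * norm (gf (x + s *\<^sub>R d) - gf x)"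
      by (rule norm_cauchy_schwarz)
    also have "\<dots> \<le> norm d * (L * (s * norm d))"
      using lip s by (intro mult_left_mono) (auto simp: norm_minus_commute)
    finally have "d \<bullet> gf (x + s *\<^sub>R d) - gf x \<bullet> d - L * (norm d)\<^sup>2 * s \<le> 0"
      by (simp add: power2_eq_square algebra_simps)
    with deriv show "\<exists>z. (\<phi> has_real_derivative z) (at s) \<and> z \<le> 0" by blast
  qed simp
  then show ?thesis by (simp add: \<phi>_def d_def)
qed

section \<open>The Constant-then-Geometric allocation\<close>

lemma sum_power_rev:
  fixes g :: real
  assumes "g \<noteq> 1"
  shows "(\<Sum>l=a..<T. g ^ (T - l - 1)) = (1 - g ^ (T - a)) / (1 - g)"
proof -
  have "(\<Sum>l=a..<T. g ^ (T - l - 1)) = (\<Sum>i<T - a. g ^ i)"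
    by (rule sum.reindex_bij_witness[of _ "\<lambda>i. T - 1 - i" "\<lambda>l. T - l - 1"]) auto
  then show ?thesis
    using assms by (simp add: sum_gp_strict)
qed

locale ctg =
  fixes T :: nat and P \<mu> \<eta> slb :: real and ts :: nat and g :: real
  assumes T_pos: "0 < T" and rate: "0 < \<mu> * \<eta>" "\<mu> * \<eta> < 1"
    and slb_pos: "0 < slb" and budget: "slb\<^sup>2 \<le> P"
    and ts_eq: "ts = ctg_switch T P \<mu> \<eta> slb" and g_eq: "g = ctg_gamma \<mu> \<eta>"
begin

lemma gamma_bounds: "0 < g" "g < 1" and gamma_sq: "g\<^sup>2 = 1 - \<mu> * \<eta>"
  using rate by (auto simp: g_eq ctg_gamma_def)

text \<open>The budget pays for \<open>T\<close> slots at power \<open>slb\<^sup>2\<close>, so after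
  fewer than \<open>T\<close> of them at least one share is left. This keeps the denominators in the
  switching condition positive.\<close>

lemma remaining_budget: "t < T \<Longrightarrow> slb\<^sup>2 \<le> real T * P - real t * slb\<^sup>2"
proof -
  assume "t < T"
  then have "real t + 1 \<le> real T" by linarith
  then have "(real t + 1) * slb\<^sup>2 \<le> real T * P"
    using budget by (intro mult_mono) auto
  then show ?thesis by (simp add: algebra_simps)
qed

lemma remaining_budget_pos: "t < T \<Longrightarrow> 0 < real T * P - real t * slb\<^sup>2"
  using remaining_budget[of t] zero_less_power[OF slb_pos, of 2] by linarith

lemma switch:
  shows switch_less: "ts < T"
    and switch_ge: "(\<Sum>l=ts..<T. g ^ (T - l - 1)) * (slb\<^sup>2 / (real T * P - real ts * slb\<^sup>2))
      \<le> g ^ (T - 1 - ts)"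
proof -
  let ?A = "{t \<in> {0..T - 1}. g ^ (T - 1 - t) \<ge>
    (1 - g ^ (T - t)) / (1 - g) * (slb\<^sup>2 / (real T * P - real t * slb\<^sup>2))}"
  \<comment> \<open>At \<open>T - 1\<close> the geometric factor is 1, and the condition says that
    the last slot can still afford \<open>slb\<^sup>2\<close>. Thus the minimum is taken over a
    nonempty set.\<close>
  have "T - 1 \<in> ?A"
    using T_pos gamma_bounds remaining_budget[of "T - 1"] remaining_budget_pos[of "T - 1"]
    by (simp add: divide_le_eq_1_pos)
  then have "Min ?A \<in> ?A" by (intro Min_in) auto
  moreover have "ts = Min ?A" by (simp add: ts_eq ctg_switch_def g_eq Let_def)
  ultimately have "ts \<in> ?A" by simp
  then show "ts < T"
    and "(\<Sum>l=ts..<T. g ^ (T - l - 1)) * (slb\<^sup>2 / (real T * P - real ts * slb\<^sup>2)) \<le> g ^ (T - 1 - ts)"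
    using T_pos gamma_bounds(2) sum_power_rev[of g T ts] by auto
qed

lemma geometric_sum_pos: "0 < (\<Sum>l=ts..<T. g ^ (T - l - 1))"
  using switch_less gamma_bounds by (intro sum_pos) auto

lemma power_before_switch: "t < ts \<Longrightarrow> ctg_power T P \<mu> \<eta> slb t = slb\<^sup>2"
  by (simp add: ctg_power_def ts_eq)

lemma power_after_switch: "ts \<le> t \<Longrightarrow> ctg_power T P \<mu> \<eta> slb t =
    g ^ (T - 1 - t) / (\<Sum>l=ts..<T. g ^ (T - l - 1)) * (real T * P - real ts * slb\<^sup>2)"
  by (simp add: ctg_power_def ts_eq g_eq Let_def)

text \<open>The condition defining the switching time says precisely that the geometric phase starts
  at power at least \<open>slb\<^sup>2\<close>; from then on the power increases.\<close>
lemma power_ge: assumes "t < T" shows "slb\<^sup>2 \<le> ctg_power T P \<mu> \<eta> slb t"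
proof (cases "t < ts")
  case False
  let ?s = "\<Sum>l=ts..<T. g ^ (T - l - 1)" and ?r = "real T * P - real ts * slb\<^sup>2"
  have r: "0 < ?r" using remaining_budget_pos switch_less by blast
  have "?s * (slb\<^sup>2 / ?r) \<le> g ^ (T - 1 - ts)" by (rule switch_ge)
  also have "\<dots> \<le> g ^ (T - 1 - t)"
    using False gamma_bounds by (intro power_decreasing) auto
  finally have "slb\<^sup>2 \<le> g ^ (T - 1 - t) / ?s * ?r"
    using r geometric_sum_pos by (simp add: field_simps)
  then show ?thesis using False by (simp add: power_after_switch)
qed (simp add: power_before_switch)

lemma weighted_inverse_power_sum:
  "(\<Sum>t<T. (1 - \<mu> * \<eta>) ^ (T - Suc t) / ctg_power T P \<mu> \<eta> slb t)
    = (\<Sum>t=0..<ts. g ^ (2 * (T - t - 1))) / slb\<^sup>2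
      + (\<Sum>t=ts..<T. g ^ (T - t - 1))\<^sup>2 / (real T * P - real ts * slb\<^sup>2)"
proof -
  let ?s = "\<Sum>l=ts..<T. g ^ (T - l - 1)" and ?r = "real T * P - real ts * slb\<^sup>2"
  let ?h = "\<lambda>t. g ^ (2 * (T - t - 1)) / ctg_power T P \<mu> \<eta> slb t"
  have "(\<Sum>t<T. (1 - \<mu> * \<eta>) ^ (T - Suc t) / ctg_power T P \<mu> \<eta> slb t) = (\<Sum>t=0..<T. ?h t)"
    by (simp add: power_mult flip: gamma_sq atLeast0LessThan)
  also have "\<dots> = (\<Sum>t=0..<ts. ?h t) + (\<Sum>t=ts..<T. ?h t)"
    using switch_less by (intro sum.atLeastLessThan_concat[symmetric]) auto
  also have "(\<Sum>t=0..<ts. ?h t) = (\<Sum>t=0..<ts. g ^ (2 * (T - t - 1))) / slb\<^sup>2"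
    by (simp add: sum_divide_distrib power_before_switch)
  \<comment> \<open>The power in the geometric phase contains \<open>g ^ (T - t - 1)\<close>, which
    cancels one of the two such factors in the numerator.\<close>
  also have "(\<Sum>t=ts..<T. ?h t) = (\<Sum>t=ts..<T. g ^ (T - t - 1) * (?s / ?r))"
  proof (rule sum.cong)
    fix t assume t: "t \<in> {ts..<T}"
    have "g ^ (2 * (T - t - 1)) = g ^ (T - t - 1) * g ^ (T - t - 1)"
      by (simp add: mult_2 power_add)
    then show "?h t = g ^ (T - t - 1) * (?s / ?r)"
      using t gamma_bounds by (simp add: power_after_switch)
  qed simp
  also have "\<dots> = ?s * (?s / ?r)"
    by (rule sum_distrib_right[symmetric])
  also have "\<dots> = ?s\<^sup>2 / ?r"
    by (simp add: power2_eq_square)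
  finally show ?thesis .
qed

end

section \<open>Gradient steps along a single bounded noise path\<close>

text \<open>The powers enter only through positivity, \<open>step_small\<close> and
  \<open>noise_small\<close>, so this analysis covers any allocation with these properties.
  \<open>fstar_le\<close> turns a gap of at most \<open>v / 2\<close> into membership in
  \<open>S\<close>.\<close>

locale local_pl =
  fixes f :: "real^'d \<Rightarrow> real" and gf :: "real^'d \<Rightarrow> real^'d" and xstar x0 :: "real^'d"
    and v L D \<mu> G \<eta> \<Delta> :: real and \<sigma> :: "nat \<Rightarrow> real" and T :: nat and S :: "(real^'d) set"
  assumes minimizer: "f xstar \<le> f y" and fstar_le: "f xstar \<le> v / 2"
    and S_eq: "S = {y. f y \<le> v}"
    and L_pos: "0 < L" and D_pos: "0 < D" and \<mu>_pos: "0 < \<mu>" and G_pos: "0 < G"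
    and grad: "gradient_field f gf" and smooth: "locally_smooth_on L D S f gf"
    and PL: "y \<in> S \<Longrightarrow> f y - f xstar \<le> 1 / (2 * \<mu>) * (norm (gf y))\<^sup>2"
    and grad_bound: "y \<in> S \<Longrightarrow> norm (gf y) \<le> G"
    and \<eta>_pos: "0 < \<eta>" and \<eta>L: "\<eta> * L \<le> 1" and \<mu>\<eta>: "\<mu> * \<eta> < 1"
    and \<sigma>_pos: "t < T \<Longrightarrow> 0 < \<sigma> t"
    and step_small: "t < T \<Longrightarrow> \<eta> * (G + G / \<sigma> t * \<Delta>) \<le> D"
    and noise_small: "t < T \<Longrightarrow> (G / \<sigma> t * \<Delta>)\<^sup>2 \<le> \<mu> * v / 2"
    and init: "f x0 - f xstar \<le> v / 2"
begin

lemma S_differentiable: "x \<in> S \<Longrightarrow> norm (y - x) \<le> D \<Longrightarrow> f differentiable (at y)"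
  using smooth unfolding locally_smooth_on_def by blast

lemma in_S: "f y - f xstar \<le> v / 2 \<Longrightarrow> y \<in> S"
  using fstar_le by (simp add: S_eq)

text \<open>The function is only known to be continuous near the sublevel set, but that already
  rules out limit points of the sublevel set outside of it.\<close>
lemma closed_S: "closed S"
  unfolding closed_sequential_limits
proof safe
  fix X l assume X: "\<forall>k. X k \<in> S" "X \<longlonglongrightarrow> l"
  obtain k where "dist (X k) l < D"
    using X(2) D_pos unfolding lim_sequentially by blast
  then have "f differentiable (at l)"
    using X(1) by (intro S_differentiable[of "X k"]) (auto simp: dist_norm norm_minus_commute)
  then have "isCont f l"
    by (rule differentiable_imp_continuous_within)
  then have "(\<lambda>k. f (X k)) \<longlonglongrightarrow> f l"
    using X(2) by (rule isCont_tendsto_compose)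
  then have "f l \<le> v"
    using X(1) by (intro LIMSEQ_le_const2) (auto simp: S_eq)
  then show "l \<in> S" by (simp add: S_eq)
qed

lemma continuous_on_S: "continuous_on S f"
  using S_differentiable D_pos
  by (intro continuous_at_imp_continuous_on ballI differentiable_imp_continuous_within) auto

lemma gradient_continuous_on_S: "continuous_on S gf"
  unfolding continuous_on_iff
proof (intro ballI allI impI)
  fix x e assume x: "x \<in> S" and e: "(0::real) < e"
  show "\<exists>d>0. \<forall>x'\<in>S. dist x' x < d \<longrightarrow> dist (gf x') (gf x) < e"
  proof (intro exI conjI ballI impI)
    \<comment> \<open>The Lipschitz estimate is available only within distance \<open>D\<close>,
      hence the minimum.\<close>
    show "0 < min D (e / L)" using D_pos L_pos e by simp
    fix y assume "y \<in> S" and y: "dist y x < min D (e / L)"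
    have "norm (gf x - gf y) \<le> L * norm (x - y)"
      using smooth x y unfolding locally_smooth_on_def by (auto simp: dist_norm)
    also have "\<dots> < e"
      using y L_pos by (simp add: dist_norm norm_minus_commute field_simps)
    finally show "dist (gf y) (gf x) < e" by (simp add: dist_norm norm_minus_commute)
  qed
qed

text \<open>In the expanded descent inequality the cross term collects \<open>- \<eta>\<close> from
  the linear part and \<open>L * \<eta>\<^sup>2\<close> from the square. It stays explicit because
  it averages out in expectation, whereas along a single path it has to be estimated.\<close>

lemma gradient_step:
  assumes x: "x \<in> S" and small: "norm (\<eta> *\<^sub>R (gf x + e)) \<le> D"
  shows "f (x - \<eta> *\<^sub>R (gf x + e)) \<le> f x - \<eta> * (1 - L * \<eta> / 2) * (norm (gf x))\<^sup>2
    - \<eta> * (1 - L * \<eta>) * (gf x \<bullet> e) + L * \<eta>\<^sup>2 / 2 * (norm e)\<^sup>2"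
proof -
  let ?g = "gf x"
  have sq: "(norm (\<eta> *\<^sub>R (?g + e)))\<^sup>2 = \<eta>\<^sup>2 * ((norm ?g)\<^sup>2 + 2 * (?g \<bullet> e) + (norm e)\<^sup>2)"
    by (simp add: power_mult_distrib power2_norm_eq_inner inner_add_left inner_add_right
        inner_commute[of e "gf x"])
  have inner: "?g \<bullet> (- (\<eta> *\<^sub>R (?g + e))) = - \<eta> * ((norm ?g)\<^sup>2 + ?g \<bullet> e)"
    by (simp add: inner_add_right power2_norm_eq_inner algebra_simps)
  have "f (x - \<eta> *\<^sub>R (?g + e)) \<le> f x + ?g \<bullet> (- (\<eta> *\<^sub>R (?g + e))) + L / 2 * (norm (\<eta> *\<^sub>R (?g + e)))\<^sup>2"
    using locally_smooth_descent[OF grad smooth x, of "x - \<eta> *\<^sub>R (?g + e)"] small by simp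
  also have "\<dots> = f x - \<eta> * (1 - L * \<eta> / 2) * (norm ?g)\<^sup>2
    - \<eta> * (1 - L * \<eta>) * (?g \<bullet> e) + L * \<eta>\<^sup>2 / 2 * (norm e)\<^sup>2"
    unfolding sq inner by (simp add: power2_eq_square field_simps)
  finally show ?thesis .
qed

lemma gap_le_gradient: "y \<in> S \<Longrightarrow> 2 * \<mu> * (f y - f xstar) \<le> (norm (gf y))\<^sup>2"
  using PL[of y] \<mu>_pos by (simp add: field_simps)

lemma gap_step:
  assumes x: "x \<in> S" and small: "norm (\<eta> *\<^sub>R (gf x + e)) \<le> D"
  shows "f (x - \<eta> *\<^sub>R (gf x + e)) - f xstar \<le> (1 - \<mu> * \<eta>) * (f x - f xstar)
    - \<eta> * (1 - L * \<eta>) * (gf x \<bullet> e) + L * \<eta>\<^sup>2 / 2 * (norm e)\<^sup>2"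
proof -
  \<comment> \<open>Since \<open>\<eta> * L \<le> 1\<close>, the factor
    \<open>1 - L * \<eta> / 2\<close> is at least \<open>1 / 2\<close>, and the gradient term
    absorbs \<open>\<mu> * \<eta>\<close> times the gap.\<close>
  have "\<eta> * (1 / 2) * (2 * \<mu> * (f x - f xstar)) \<le> \<eta> * (1 - L * \<eta> / 2) * (norm (gf x))\<^sup>2"
    using \<eta>_pos \<eta>L \<mu>_pos minimizer[of x] gap_le_gradient[OF x]
    by (intro mult_mono mult_left_mono mult_nonneg_nonneg) (auto simp: mult.commute)
  with gradient_step[OF x small] show ?thesis by (simp add: algebra_simps)
qed

text \<open>Young's inequality on the cross term leaves a recursion whose noise term is at most
  half of what the contraction absorbs at level \<open>v / 2\<close>.\<close>
lemma gap_step_le: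
  assumes x: "x \<in> S" and gap: "f x - f xstar \<le> v / 2"
    and small: "norm (\<eta> *\<^sub>R (gf x + e)) \<le> D" and e: "(norm e)\<^sup>2 \<le> \<mu> * v / 2"
  shows "f (x - \<eta> *\<^sub>R (gf x + e)) - f xstar \<le> v / 2"
proof -
  let ?g = "gf x"
  have "0 \<le> (norm (?g + e))\<^sup>2" by simp
  then have young: "- (?g \<bullet> e) \<le> (norm ?g)\<^sup>2 / 2 + (norm e)\<^sup>2 / 2"
    by (simp add: power2_norm_eq_inner inner_add_left inner_add_right inner_commute[of e "gf x"])
  have "\<eta> * (1 - L * \<eta>) * (- (?g \<bullet> e)) \<le> \<eta> * (1 - L * \<eta>) * ((norm ?g)\<^sup>2 / 2 + (norm e)\<^sup>2 / 2)"
    using \<eta>_pos \<eta>L by (intro mult_left_mono young mult_nonneg_nonneg) (auto simp: mult.commute)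
  \<comment> \<open>With Young's inequality the terms in \<open>L\<close> cancel, leaving exactly
    \<open>\<eta> / 2\<close> on both squares.\<close>
  moreover have "f x - \<eta> * (1 - L * \<eta> / 2) * (norm ?g)\<^sup>2
      + \<eta> * (1 - L * \<eta>) * ((norm ?g)\<^sup>2 / 2 + (norm e)\<^sup>2 / 2) + L * \<eta>\<^sup>2 / 2 * (norm e)\<^sup>2
      = f x - \<eta> / 2 * (norm ?g)\<^sup>2 + \<eta> / 2 * (norm e)\<^sup>2"
    by (simp add: power2_eq_square field_simps)
  ultimately have "f (x - \<eta> *\<^sub>R (?g + e)) \<le> f x - \<eta> / 2 * (norm ?g)\<^sup>2 + \<eta> / 2 * (norm e)\<^sup>2"
    using gradient_step[OF x small] by linarith
  moreover have "\<eta> / 2 * (2 * \<mu> * (f x - f xstar)) \<le> \<eta> / 2 * (norm ?g)\<^sup>2"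
    using \<eta>_pos by (intro mult_left_mono gap_le_gradient x) auto
  moreover have "\<eta> / 2 * (norm e)\<^sup>2 \<le> \<eta> / 2 * (\<mu> * v / 2)"
    using \<eta>_pos by (intro mult_left_mono e) auto
  moreover have "(1 - \<mu> * \<eta>) * (f x - f xstar) \<le> (1 - \<mu> * \<eta>) * (v / 2)"
    using \<mu>\<eta> gap by (intro mult_left_mono) auto
  \<comment> \<open>The sign comes from the noise bound, as a square lies below
    \<open>\<mu> * v / 2\<close>. The estimates add up to
    \<open>v / 2 - \<mu> * \<eta> * v / 4\<close>, which this brings below
    \<open>v / 2\<close>.\<close>
  moreover have "0 \<le> \<mu> * \<eta> * v"
    using mult_nonneg_nonneg[of \<eta> "\<mu> * v / 2"] order_trans[OF zero_le_power2 e] \<eta>_pos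
    by (simp add: mult_ac)
  ultimately show ?thesis by (simp add: algebra_simps)
qed

lemma noise_step_small:
  assumes "t < T" "x \<in> S" "norm w \<le> \<Delta>"
  shows "norm (\<eta> *\<^sub>R (gf x + (G / \<sigma> t) *\<^sub>R w)) \<le> D"
    and "(norm ((G / \<sigma> t) *\<^sub>R w))\<^sup>2 \<le> \<mu> * v / 2"
proof -
  have w: "norm ((G / \<sigma> t) *\<^sub>R w) \<le> G / \<sigma> t * \<Delta>"
    using assms G_pos \<sigma>_pos[of t] by (simp add: divide_right_mono)
  then have "norm (gf x + (G / \<sigma> t) *\<^sub>R w) \<le> G + G / \<sigma> t * \<Delta>"
    using norm_triangle_ineq[of "gf x" "(G / \<sigma> t) *\<^sub>R w"] grad_bound[OF assms(2)] by linarith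
  then have "\<eta> * norm (gf x + (G / \<sigma> t) *\<^sub>R w) \<le> \<eta> * (G + G / \<sigma> t * \<Delta>)"
    using \<eta>_pos by (intro mult_left_mono) auto
  also note step_small[OF assms(1)]
  finally show "norm (\<eta> *\<^sub>R (gf x + (G / \<sigma> t) *\<^sub>R w)) \<le> D"
    using \<eta>_pos by simp
  have "(norm ((G / \<sigma> t) *\<^sub>R w))\<^sup>2 \<le> (G / \<sigma> t * \<Delta>)\<^sup>2"
    by (intro power_mono w) simp
  with noise_small[OF assms(1)] show "(norm ((G / \<sigma> t) *\<^sub>R w))\<^sup>2 \<le> \<mu> * v / 2" by linarith
qed

text \<open>The invariant is the gap bound rather than membership in \<open>S\<close>: it implies
  membership through \<open>in_S\<close> and reproduces itself through
  \<open>gap_step_le\<close>.\<close>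

lemma pagd_gap_le:
  assumes w: "\<And>s. s < T \<Longrightarrow> norm (w s) \<le> \<Delta>" and "t \<le> T"
  shows "f (pagd gf \<eta> G \<sigma> x0 w t) - f xstar \<le> v / 2"
  using assms(2)
proof (induction t)
  case 0
  then show ?case using init by simp
next
  case (Suc t)
  let ?x = "pagd gf \<eta> G \<sigma> x0 w t"
  have gap: "f ?x - f xstar \<le> v / 2" using Suc by simp
  have t: "t < T" using Suc by simp
  show ?case
    using gap_step_le[OF in_S[OF gap] gap noise_step_small[OF t in_S[OF gap] w[OF t]]] by simp
qed

text \<open>Nothing is known about the measurability of \<open>f\<close> and its gradient away from the sublevel
  set, hence they are truncated there; almost surely this does not affect the iterates.\<close>
definition trunc_grad :: "real^'d \<Rightarrow> real^'d" where
  "trunc_grad y = (if y \<in> S then gf y else 0)"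

definition trunc_gap :: "real^'d \<Rightarrow> real" where
  "trunc_gap y = (if y \<in> S then f y - f xstar else 0)"

text \<open>Closedness makes \<open>S\<close> a Borel set, and continuity on each of the two pieces
  then suffices.\<close>

lemma measurable_trunc_grad [measurable]: "trunc_grad \<in> borel_measurable borel"
  unfolding trunc_grad_def[abs_def]
  by (intro borel_measurable_continuous_on_if borel_closed closed_S gradient_continuous_on_S
      continuous_on_const)

lemma measurable_trunc_gap [measurable]: "trunc_gap \<in> borel_measurable borel"
  unfolding trunc_gap_def[abs_def]
  by (intro borel_measurable_continuous_on_if borel_closed closed_S continuous_on_diff
      continuous_on_S continuous_on_const)

lemma norm_trunc_grad_le: "norm (trunc_grad y) \<le> G"
  using grad_bound G_pos by (simp add: trunc_grad_def)

lemma abs_trunc_gap_le: "\<bar>trunc_gap y\<bar> \<le> \<bar>v - f xstar\<bar>"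
  unfolding trunc_gap_def using minimizer[of y] by (auto simp: S_eq)

lemma pagd_trunc_grad:
  assumes w: "\<And>s. s < T \<Longrightarrow> norm (w s) \<le> \<Delta>" and "t \<le> T"
  shows "pagd trunc_grad \<eta> G \<sigma> x0 w t = pagd gf \<eta> G \<sigma> x0 w t"
  using assms(2)
proof (induction t)
  case (Suc t)
  then have "pagd gf \<eta> G \<sigma> x0 w t \<in> S"
    by (intro in_S pagd_gap_le w) auto
  with Suc show ?case by (simp add: trunc_grad_def)
qed simp

end

section \<open>The expected optimality gap\<close>

locale noisy_pagd = local_pl f + prob_space M
  for f :: "real^'d \<Rightarrow> real" and M :: "'w measure" +
  fixes n :: "nat \<Rightarrow> 'w \<Rightarrow> real^'d" and \<sigma>N :: real
  assumes indep: "indep_vars (\<lambda>_. borel) n UNIV"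
    and noise_mean: "\<And>t. integral\<^sup>L M (n t) = 0"
    and noise_var: "\<And>t. integral\<^sup>L M (\<lambda>\<omega>. (norm (n t \<omega>))\<^sup>2) = \<sigma>N\<^sup>2"
    and noise_bound: "\<And>t. AE \<omega> in M. norm (n t \<omega>) \<le> \<Delta>"
begin

text \<open>Driving the recursion by \<open>trunc_grad\<close> makes the iterates Borel measurable
  on \<open>M\<close>; almost surely they coincide with those driven by \<open>gf\<close>.\<close>

definition iter :: "nat \<Rightarrow> 'w \<Rightarrow> real^'d" where
  "iter t \<omega> = pagd trunc_grad \<eta> G \<sigma> x0 (\<lambda>s. n s \<omega>) t"

lemma measurable_noise [measurable]: "n t \<in> borel_measurable M"
  using indep unfolding indep_vars_def by auto

lemma measurable_iter [measurable]: "iter t \<in> borel_measurable M"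
  unfolding iter_def[abs_def] by (intro measurable_pagd) auto

lemma AE_noise_bound: "AE \<omega> in M. \<forall>s. norm (n s \<omega>) \<le> \<Delta>"
  using noise_bound by (simp add: AE_all_countable)

lemma integrable_noise: "integrable M (n t)"
  using noise_bound[of t] by (intro integrable_const_bound) auto

lemma integrable_noise_sq: "integrable M (\<lambda>\<omega>. (norm (n t \<omega>))\<^sup>2)"
proof (rule integrable_const_bound)
  show "AE \<omega> in M. norm ((norm (n t \<omega>))\<^sup>2) \<le> \<Delta>\<^sup>2"
    using noise_bound[of t] by eventually_elim (auto intro: power_mono)
qed simp

lemma integrable_gap: "integrable M (\<lambda>\<omega>. trunc_gap (iter t \<omega>))"
  using abs_trunc_gap_le by (intro integrable_const_bound) auto

lemma integrable_grad: "integrable M (\<lambda>\<omega>. trunc_grad (iter t \<omega>))"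
  using norm_trunc_grad_le by (intro integrable_const_bound) auto

text \<open>The noise is grouped into the disjoint index sets \<open>{..<t}\<close> and
  \<open>{t}\<close>; the gradient at time \<open>t\<close> is a measurable function of the first
  block.\<close>

lemma indep_grad_noise: "indep_var borel (\<lambda>\<omega>. trunc_grad (iter t \<omega>)) borel (n t)"
proof -
  let ?P = "\<lambda>w. trunc_grad (pagd trunc_grad \<eta> G \<sigma> x0 w t)"
  have P: "?P \<in> measurable (PiM {..<t} (\<lambda>_. borel)) borel"
    by (intro measurable_compose[OF _ measurable_trunc_grad] measurable_pagd measurable_trunc_grad
        measurable_component_singleton) auto
  have N: "(\<lambda>w. w t) \<in> measurable (PiM {t} (\<lambda>_. borel :: (real^'d) measure)) borel"
    by (intro measurable_component_singleton) auto
  have "indep_var borel (?P \<circ> (\<lambda>\<omega>. restrict (\<lambda>i. n i \<omega>) {..<t}))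
      borel ((\<lambda>w. w t) \<circ> (\<lambda>\<omega>. restrict (\<lambda>i. n i \<omega>) {t}))"
    by (intro indep_var_compose[OF indep_var_restrict[OF indep]] P N) auto
  also have "(\<lambda>w. w t) \<circ> (\<lambda>\<omega>. restrict (\<lambda>i. n i \<omega>) {t}) = n t" by auto
  also have "?P \<circ> (\<lambda>\<omega>. restrict (\<lambda>i. n i \<omega>) {..<t}) = (\<lambda>\<omega>. trunc_grad (iter t \<omega>))"
    unfolding iter_def comp_def by (intro ext arg_cong[of _ _ trunc_grad] pagd_cong) auto
  finally show ?thesis .
qed

lemma expectation_grad_noise: "expectation (\<lambda>\<omega>. trunc_grad (iter t \<omega>) \<bullet> n t \<omega>) = 0"
  by (simp add: expectation_inner_indep[OF indep_grad_noise integrable_grad integrable_noise]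
      noise_mean)

lemma expectation_gap_step:
  assumes t: "t < T"
  shows "expectation (\<lambda>\<omega>. trunc_gap (iter (Suc t) \<omega>))
    \<le> (1 - \<mu> * \<eta>) * expectation (\<lambda>\<omega>. trunc_gap (iter t \<omega>))
      + L * \<eta>\<^sup>2 / 2 * ((G / \<sigma> t)\<^sup>2 * \<sigma>N\<^sup>2)"
proof -
  let ?c = "\<eta> * (1 - L * \<eta>) * (G / \<sigma> t)" and ?k = "L * \<eta>\<^sup>2 / 2 * (G / \<sigma> t)\<^sup>2"
  let ?u = "\<lambda>\<omega>. (1 - \<mu> * \<eta>) * trunc_gap (iter t \<omega>) - ?c * (trunc_grad (iter t \<omega>) \<bullet> n t \<omega>)
      + ?k * (norm (n t \<omega>))\<^sup>2"
  note int = integrable_gap integrable_noise_sq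
    integrable_inner_indep[OF indep_grad_noise integrable_grad integrable_noise]
  \<comment> \<open>Where all noise is bounded, both iterates lie in \<open>S\<close>, the
    truncations are inactive, and the pathwise \<open>gap_step\<close> applies.\<close>
  have "AE \<omega> in M. trunc_gap (iter (Suc t) \<omega>) \<le> ?u \<omega>"
    using AE_noise_bound
  proof eventually_elim
    case (elim \<omega>)
    let ?w = "\<lambda>s. n s \<omega>"
    let ?x = "pagd gf \<eta> G \<sigma> x0 ?w t" and ?y = "pagd gf \<eta> G \<sigma> x0 ?w (Suc t)"
    have w: "norm (?w s) \<le> \<Delta>" for s using elim by blast
    have S: "?x \<in> S" "?y \<in> S"
      using t by (intro in_S pagd_gap_le w; simp)+
    have iter: "iter t \<omega> = ?x" "iter (Suc t) \<omega> = ?y"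
      unfolding iter_def using t by (intro pagd_trunc_grad w; simp)+
    have sq: "(norm ((G / \<sigma> t) *\<^sub>R n t \<omega>))\<^sup>2 = (G / \<sigma> t)\<^sup>2 * (norm (n t \<omega>))\<^sup>2"
      by (simp add: power_mult_distrib power_divide)
    have trunc: "trunc_gap (iter (Suc t) \<omega>) = f ?y - f xstar"
      "trunc_gap (iter t \<omega>) = f ?x - f xstar" "trunc_grad (iter t \<omega>) = gf ?x"
      using S by (simp_all only: iter trunc_gap_def trunc_grad_def if_True)
    show ?case
      using gap_step[OF S(1) noise_step_small(1)[OF t S(1) w[of t]]]
      by (simp only: trunc pagd.simps sq inner_scaleR_right mult.assoc)
  qed
  then have "expectation (\<lambda>\<omega>. trunc_gap (iter (Suc t) \<omega>)) \<le> expectation ?u"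
    using int by (intro integral_mono_AE) auto
  also have "\<dots> = (1 - \<mu> * \<eta>) * expectation (\<lambda>\<omega>. trunc_gap (iter t \<omega>)) + ?k * \<sigma>N\<^sup>2"
    using int by (simp add: expectation_grad_noise noise_var)
  finally show ?thesis by (simp add: mult.assoc)
qed

lemma expectation_gap_le:
  "expectation (\<lambda>\<omega>. trunc_gap (iter T \<omega>)) \<le> (1 - \<mu> * \<eta>) ^ T * (f x0 - f xstar)
    + L * G\<^sup>2 * \<eta>\<^sup>2 * \<sigma>N\<^sup>2 * (\<Sum>t<T. (1 - \<mu> * \<eta>) ^ (T - Suc t) / (\<sigma> t)\<^sup>2)"
proof -
  have "expectation (\<lambda>\<omega>. trunc_gap (iter T \<omega>))
    \<le> (1 - \<mu> * \<eta>) ^ T * expectation (\<lambda>\<omega>. trunc_gap (iter 0 \<omega>))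
      + (\<Sum>t<T. (1 - \<mu> * \<eta>) ^ (T - Suc t) * (L * \<eta>\<^sup>2 / 2 * ((G / \<sigma> t)\<^sup>2 * \<sigma>N\<^sup>2)))"
    using \<mu>\<eta> expectation_gap_step by (intro linear_recurrence_bound) auto
  also have "(\<lambda>\<omega>. trunc_gap (iter 0 \<omega>)) = (\<lambda>_. f x0 - f xstar)"
    using in_S[OF init] by (simp add: iter_def trunc_gap_def)
  also have "(\<Sum>t<T. (1 - \<mu> * \<eta>) ^ (T - Suc t) * (L * \<eta>\<^sup>2 / 2 * ((G / \<sigma> t)\<^sup>2 * \<sigma>N\<^sup>2)))
      = L * G\<^sup>2 * \<eta>\<^sup>2 * \<sigma>N\<^sup>2 / 2 * (\<Sum>t<T. (1 - \<mu> * \<eta>) ^ (T - Suc t) / (\<sigma> t)\<^sup>2)"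
    by (simp add: sum_distrib_left power_divide mult_ac)
  \<comment> \<open>The recursion yields half of the noise constant in the claim, so the factor
    \<open>1 / 2\<close> is dropped here.\<close>
  also have "\<dots> \<le> L * G\<^sup>2 * \<eta>\<^sup>2 * \<sigma>N\<^sup>2 * (\<Sum>t<T. (1 - \<mu> * \<eta>) ^ (T - Suc t) / (\<sigma> t)\<^sup>2)"
    using L_pos \<mu>\<eta> by (intro mult_right_mono sum_nonneg) auto
  finally show ?thesis by (simp add: prob_space)
qed

end

section \<open>Convergence of PAGD under the allocation\<close>

theorem theorem5:
  fixes f :: "real^'d \<Rightarrow> real"
    and gf :: "real^'d \<Rightarrow> real^'d"
    and xstar x0 :: "real^'d"
    and v L D \<mu> G \<Delta> \<eta> \<gamma> \<sigma>N \<sigma>p \<sigma>lb :: real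
    and T ts :: nat
    and M :: "'w measure"
    and n :: "nat \<Rightarrow> 'w \<Rightarrow> real^'d"
    and \<sigma> :: "nat \<Rightarrow> real"
    and S :: "(real^'d) set"
    and x :: "nat \<Rightarrow> 'w \<Rightarrow> real^'d"
  assumes f_nonneg: "\<And>y. 0 \<le> f y"
    and minimizer: "\<And>y. f xstar \<le> f y"
    and v_pos: "v > 0"
    and S_eq: "S = {y. f y \<le> v}"
    and pos: "L > 0" "D > 0" "\<mu> > 0" "G > 0"
    and grad: "gradient_field f gf"
    and smooth: "locally_smooth_on L D S f gf"
    and PL: "\<And>y. y \<in> S \<Longrightarrow> f y - f xstar \<le> 1 / (2 * \<mu>) * (norm (gf y))\<^sup>2"
    and grad_bound: "\<And>y. y \<in> S \<Longrightarrow> norm (gf y) \<le> G"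
    and T_ge: "T \<ge> 1"
    and prob: "prob_space M"
    and indep: "prob_space.indep_vars M (\<lambda>_. borel) n UNIV"
    and noise_mean: "\<And>t. integral\<^sup>L M (n t) = 0"
    and noise_var: "\<And>t. integral\<^sup>L M (\<lambda>\<omega>. (norm (n t \<omega>))\<^sup>2) = \<sigma>N\<^sup>2"
    and \<Delta>_pos: "\<Delta> > 0"
    and noise_bound: "\<And>t. AE \<omega> in M. norm (n t \<omega>) \<le> \<Delta>"
    and \<eta>: "0 < \<eta>" "\<eta> < min (D / G) (1 / (4 * L))" "\<mu> * \<eta> < 1"
    and \<gamma>_eq: "\<gamma> = sqrt (1 - \<mu> * \<eta>)"
    and \<sigma>lb_pos: "\<sigma>lb > 0"
    and \<sigma>lb_eq: "\<sigma>lb\<^sup>2 = G\<^sup>2 * \<Delta>\<^sup>2 * max (\<eta>\<^sup>2 / (D - G * \<eta>)\<^sup>2) (2 / (\<mu> * v))"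
    and budget: "\<sigma>p\<^sup>2 \<ge> \<sigma>lb\<^sup>2"
    and ts_eq: "ts = ctg_switch T (\<sigma>p\<^sup>2) \<mu> \<eta> \<sigma>lb"
    and \<sigma>_eq: "\<sigma> = ctg_sigma T (\<sigma>p\<^sup>2) \<mu> \<eta> \<sigma>lb"
    and x0: "f x0 \<le> v / 2"
    and x_eq: "\<And>t \<omega>. x t \<omega> = pagd gf \<eta> G \<sigma> x0 (\<lambda>s. n s \<omega>) t"
  shows "(AE \<omega> in M. \<forall>t\<in>{0..T}. x t \<omega> \<in> S) \<and>
    integrable (completion M) (\<lambda>\<omega>. f (x T \<omega>) - f xstar) \<and>
    integral\<^sup>L (completion M) (\<lambda>\<omega>. f (x T \<omega>) - f xstar)
      \<le> (1 - \<mu> * \<eta>) ^ T * (f x0 - f xstar)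
        + L * G\<^sup>2 * \<eta>\<^sup>2 * \<sigma>N\<^sup>2 *
          ((\<Sum>t=0..<ts. \<gamma> ^ (2 * (T - t - 1))) / \<sigma>lb\<^sup>2
           + (\<Sum>t=ts..<T. \<gamma> ^ (T - t - 1))\<^sup>2 / (real T * \<sigma>p\<^sup>2 - real ts * \<sigma>lb\<^sup>2))"
proof -
  interpret ctg T "\<sigma>p\<^sup>2" \<mu> \<eta> \<sigma>lb ts \<gamma>
    using T_ge pos \<eta> \<sigma>lb_pos budget ts_eq \<gamma>_eq
    by unfold_locales (auto simp: ctg_gamma_def)
  have D: "0 < D - G * \<eta>" and \<eta>L: "\<eta> * L \<le> 1"
    using pos \<eta> by (auto simp: field_simps)
  have \<sigma>_sq: "(\<sigma> t)\<^sup>2 = ctg_power T (\<sigma>p\<^sup>2) \<mu> \<eta> \<sigma>lb t"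
    and \<sigma>_ge: "\<sigma>lb \<le> \<sigma> t" if "t < T" for t
    using order_trans[OF zero_le_power2 power_ge[OF that]]
      real_le_rsqrt[OF power_ge[OF that]]
    by (auto simp: \<sigma>_eq ctg_sigma_def)
  have \<sigma>_pos: "0 < \<sigma> t" if "t < T" for t
    using \<sigma>_ge[OF that] \<sigma>lb_pos by linarith
  interpret noisy_pagd gf xstar x0 v L D \<mu> G \<eta> \<Delta> \<sigma> T S f M n \<sigma>N
  proof (intro noisy_pagd.intro local_pl.intro noisy_pagd_axioms.intro)
    show "f xstar \<le> v / 2" using minimizer[of x0] x0 by linarith
    show "f x0 - f xstar \<le> v / 2" using f_nonneg[of xstar] x0 by linarith
    fix t assume t: "t < T"
    \<comment> \<open>The first entry of the maximum in \<open>\<sigma>lb\<^sup>2\<close> is the one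
      that keeps each step within \<open>D\<close>.\<close>
    have "(G * \<Delta> * (\<eta> / (D - G * \<eta>)))\<^sup>2 \<le> \<sigma>lb\<^sup>2"
      unfolding \<sigma>lb_eq power_mult_distrib power_divide by (intro mult_left_mono) auto
    then have "G * \<Delta> * (\<eta> / (D - G * \<eta>)) \<le> \<sigma>lb"
      by (rule power2_le_imp_le[OF _ less_imp_le[OF \<sigma>lb_pos]])
    also note \<sigma>_ge[OF t]
    finally have "G * \<Delta> * \<eta> \<le> \<sigma> t * (D - G * \<eta>)"
      using D by (simp add: pos_divide_le_eq)
    then have "G * \<Delta> * \<eta> / \<sigma> t \<le> D - G * \<eta>"
      using \<sigma>_pos[OF t] by (simp add: pos_divide_le_eq mult.commute)
    then show "\<eta> * (G + G / \<sigma> t * \<Delta>) \<le> D"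
      by (simp add: algebra_simps)
    \<comment> \<open>The second entry bounds the squared decoded noise by
      \<open>\<mu> * v / 2\<close>, the level that \<open>gap_step_le\<close> tolerates.\<close>
    have "G\<^sup>2 * \<Delta>\<^sup>2 * (2 / (\<mu> * v)) \<le> \<sigma>lb\<^sup>2"
      unfolding \<sigma>lb_eq by (intro mult_left_mono) auto
    also have "\<dots> \<le> (\<sigma> t)\<^sup>2"
      using \<sigma>lb_pos \<sigma>_ge[OF t] by (intro power_mono) auto
    finally have "G\<^sup>2 * \<Delta>\<^sup>2 \<le> (\<sigma> t)\<^sup>2 * (\<mu> * v / 2)"
      using pos(3) v_pos by (simp add: field_simps)
    then have "G\<^sup>2 * \<Delta>\<^sup>2 / (\<sigma> t)\<^sup>2 \<le> \<mu> * v / 2"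
      using \<sigma>_pos[OF t] by (simp add: pos_divide_le_eq mult.commute)
    then show "(G / \<sigma> t * \<Delta>)\<^sup>2 \<le> \<mu> * v / 2"
      by (simp add: power_mult_distrib power_divide)
  qed (fact+)
  have inS: "AE \<omega> in M. \<forall>t\<in>{0..T}. x t \<omega> \<in> S"
    using AE_noise_bound by eventually_elim (auto simp: x_eq intro!: in_S pagd_gap_le)
  have "AE \<omega> in M. x T \<omega> = iter T \<omega>"
    using AE_noise_bound by eventually_elim (simp add: x_eq iter_def pagd_trunc_grad)
  \<comment> \<open>The last iterate lies in \<open>S\<close> almost surely, so the actual gap
    agrees there with a measurable bounded function, and its integral is transferred to the
    completion.\<close>
  with inS have "AE \<omega> in M. f (x T \<omega>) - f xstar = trunc_gap (iter T \<omega>)"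
    by eventually_elim (metis trunc_gap_def atLeastAtMost_iff le0 order_refl)
  note completion = integrable_completion_AE[OF integrable_gap this]
    integral_completion_AE[OF integrable_gap this]
  have "(\<Sum>t<T. (1 - \<mu> * \<eta>) ^ (T - Suc t) / (\<sigma> t)\<^sup>2)
      = (\<Sum>t<T. (1 - \<mu> * \<eta>) ^ (T - Suc t) / ctg_power T (\<sigma>p\<^sup>2) \<mu> \<eta> \<sigma>lb t)"
    by (intro sum.cong refl) (simp add: \<sigma>_sq)
  with inS completion expectation_gap_le weighted_inverse_power_sum show ?thesis
    by simp
qed

end
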